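(* Let $m,k$ be positive integers with $k\ge 3$. Suppose $D(mk,k)=\{d_0,d_1,\ldots,d_j\}$ for some $j\ge 0$, where $d_0<d_1<\cdots<d_j$, and let $d_{-1}:=0$. Then $$mk-m\;\ge\; b(mk,k)\;\ge\; mk-\sum_{i=0}^{j}(d_i-d_{i-1})(m-d_i+1).$$
   Context: For positive integers $k,N,d$ with $k\ge 3$, a $k$-term cyclic arithmetic progression mod $N$ with common difference $d$ is a $k$-element subset of $\mathbb{Z}_N=\mathbb{Z}/N\mathbb{Z}$ of the form $\{t,t+d,\ldots,t+(k-1)d\}$ for some $t\in\mathbb{Z}_N$ (so these $k$ elements are pairwise distinct mod $N$). Progressions are sets, so the same progression may have several bases $t$ and common differences $d$. $b(N,k)$ denotes the maximum size of a subset $B\subseteq\mathbb{Z}_N$ that contains (as a subset) no $k$-term cyclic arithmetic progression mod $N$. $D(N,k)$ denotes the set of values $\gcd(d,k)$, where $d$ ranges over all possible common differences ($1\le d\le N-1$) of $k$-term cyclic arithmetic progressions mod $N$. *)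

theory Defs
  imports Main
begin

text \<open>\<open>\<int>\<^sub>N\<close> is represented by its residues \<open>{0..<N}\<close>, with arithmetic modulo \<open>N\<close>.\<close>

text \<open>The condition \<open>card P = k\<close> says that the \<open>k\<close> listed terms are pairwise distinct modulo \<open>N\<close>.\<close>

definition cyclic_ap :: "nat \<Rightarrow> nat \<Rightarrow> nat \<Rightarrow> nat set \<Rightarrow> bool" where
  "cyclic_ap N k d P \<longleftrightarrow>
     0 < d \<and> card P = k \<and> (\<exists>t\<in>{0..<N}. P = (\<lambda>i. (t + i * d) mod N) ` {0..<k})"

definition cyclic_ap_free :: "nat \<Rightarrow> nat \<Rightarrow> nat set \<Rightarrow> bool" where
  "cyclic_ap_free N k B \<longleftrightarrow> \<not> (\<exists>d P. cyclic_ap N k d P \<and> P \<subseteq> B)"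

definition max_ap_free :: "nat \<Rightarrow> nat \<Rightarrow> nat" where
  "max_ap_free N k = Max {card B |B. B \<subseteq> {0..<N} \<and> cyclic_ap_free N k B}"

definition ap_diff_gcds :: "nat \<Rightarrow> nat \<Rightarrow> nat set" where
  "ap_diff_gcds N k = {gcd d k |d. d \<in> {1..N - 1} \<and> (\<exists>P. cyclic_ap N k d P)}"

end

theory Submission imports Defs
begin

text \<open>
  The upper bound holds because \<open>\<int>\<^bsub>mk\<^esub>\<close> splits into \<open>m\<close> intervals of length \<open>k\<close>, each of which is a
  progression with difference 1 and so must lose a point.
  For the lower bound, reduce modulo \<open>k\<close>. A \<open>k\<close>-term progression with difference \<open>e\<close> and
  \<open>g = gcd e k\<close> meets a residue class modulo \<open>k\<close> in \<open>g\<close> points or not at all, and it meets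
  one of the classes \<open>0, \<dots>, g - 1\<close>. Each class has \<open>m\<close> points, so deleting any \<open>m - g + 1\<close> of
  them destroys all progressions with gcd at least \<open>g\<close> that meet the class. Hence for each \<open>r < d\<^sub>j\<close>
  it suffices to delete \<open>m - d\<^sub>i + 1\<close> points of class \<open>r\<close>, where \<open>d\<^sub>i\<close> is the least element
  of \<open>D(mk, k)\<close> exceeding \<open>r\<close>.
\<close>

lemma finite_free_cards: "finite {card B |B. B \<subseteq> {0..<N::nat} \<and> cyclic_ap_free N k B}"
proof -
  have "{card B |B. B \<subseteq> {0..<N} \<and> cyclic_ap_free N k B} \<subseteq> card ` Pow {0..<N}" by auto
  then show ?thesis by (rule finite_subset) simp
qed

text \<open>Together with \<open>finite_free_cards\<close> this guarantees that the
  \<open>Max\<close> in \<open>max_ap_free\<close> is attained; positivity of \<open>k\<close> rules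
  out an empty progression.\<close>

lemma cyclic_ap_free_empty:
  assumes "k > 0"
  shows "cyclic_ap_free N k {}"
  using assms by (auto simp: cyclic_ap_free_def cyclic_ap_def)

lemma cyclic_ap_interval:
  assumes "s < m" "k > 0"
  shows "cyclic_ap (m * k) k 1 {s * k..<s * k + k}"
proof -
  have "Suc s * k \<le> m * k" using assms(1) by (intro mult_le_mono1) simp
  then have le: "s * k + k \<le> m * k" by simp
  have "(\<lambda>i. (s * k + i * 1) mod (m * k)) ` {0..<k} = (\<lambda>i. i + s * k) ` {0..<k}"
    using le by (intro image_cong) auto
  also have "\<dots> = {s * k..<s * k + k}"
    by (simp add: add.commute)
  finally have "{s * k..<s * k + k} = (\<lambda>i. (s * k + i * 1) mod (m * k)) ` {0..<k}" ..
  moreover have "s * k \<in> {0..<m * k}" using assms by simp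
  ultimately have "\<exists>t\<in>{0..<m * k}. {s * k..<s * k + k} = (\<lambda>i. (t + i * 1) mod (m * k)) ` {0..<k}"
    by blast
  then show ?thesis
    unfolding cyclic_ap_def by simp
qed

lemma max_ap_free_le:
  assumes "k > 0"
  shows "max_ap_free (m * k) k + m \<le> m * k"
proof -
  have "card B + m \<le> m * k" if B: "B \<subseteq> {0..<m * k}" "cyclic_ap_free (m * k) k B" for B
  proof -
    have "\<forall>s<m. \<exists>x. x div k = s \<and> x \<in> {0..<m * k} - B"
    proof (intro allI impI)
      fix s assume s: "s < m"
      with B(2) cyclic_ap_interval[OF s assms]
      obtain x where x: "x \<in> {s * k..<s * k + k}" "x \<notin> B"
        unfolding cyclic_ap_free_def by blast
      have "x div k = s"
        using x(1) by (intro div_nat_eqI) (auto simp: algebra_simps)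
      with s have "x < m * k"
        using assms by (simp add: div_less_iff_less_mult[symmetric])
      with x \<open>x div k = s\<close> show "\<exists>x. x div k = s \<and> x \<in> {0..<m * k} - B" by auto
    qed
    \<comment> \<open>Division by \<open>k\<close> maps the points missing from \<open>B\<close>
      onto all \<open>m\<close> interval indices, so at least \<open>m\<close> points are
      missing.\<close>
    then have "{..<m} \<subseteq> (\<lambda>x. x div k) ` ({0..<m * k} - B)" by force
    then have "card {..<m} \<le> card ({0..<m * k} - B)"
      by (rule surj_card_le[rotated]) simp
    also have "\<dots> = m * k - card B"
      using B(1) by (subst card_Diff_subset) (auto intro: finite_subset)
    finally show ?thesis
      using card_mono[OF _ B(1)] by simp
  qed
  moreover have "max_ap_free (m * k) k \<in> {card B |B. B \<subseteq> {0..<m * k} \<and> cyclic_ap_free (m * k) k B}"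
    unfolding max_ap_free_def
    using finite_free_cards cyclic_ap_free_empty[OF assms] by (intro Max_in) auto
  ultimately show ?thesis by auto
qed

text \<open>With \<open>g = gcd e k\<close>, the multiples of \<open>e\<close> modulo
  \<open>k\<close> are the multiples of \<open>g\<close>, so some term is congruent to
  \<open>t mod g\<close>. Residues modulo \<open>k\<close> recur with index period
  \<open>h = k div g\<close>, which fits \<open>g\<close> times into the \<open>k\<close> indices;
  distinctness of the terms keeps these points apart.\<close>

lemma cyclic_ap_class:
  assumes ap: "cyclic_ap (m * k) k e P" and k: "k > 0"
  obtains r where "r < gcd e k" "gcd e k \<le> card {x \<in> P. x mod k = r}"
proof -
  define g h where "g = gcd e k" and "h = k div g"
  from ap obtain t where e: "e > 0" and card: "card P = k"
    and P: "P = (\<lambda>i. (t + i * e) mod (m * k)) ` {0..<k}"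
    unfolding cyclic_ap_def by auto
  have g: "g > 0" using k by (simp add: g_def)
  have kgh: "k = g * h" by (simp add: g_def h_def)
  have h: "h > 0" using k kgh by (cases h) auto
  have inj: "inj_on (\<lambda>i. (t + i * e) mod (m * k)) {0..<k}"
    using card P by (intro eq_card_imp_inj_on) auto
  define r w where "r = t mod g" and "w = t div g"
  have t: "t = g * w + r" by (simp add: r_def w_def)
  have r: "r < g" using g by (simp add: r_def)
  obtain x y where xy: "e * x = k * y + g"
    using bezout_nat[of e k] e by (auto simp: g_def)
  obtain k' where k': "k = Suc k'" using k by (cases k) auto
  \<comment> \<open>Modulo \<open>k\<close>, the factor \<open>k' = k - 1\<close> acts as -1 and
    \<open>e * x\<close> is \<open>g\<close>, so \<open>i0 * e\<close> cancels the summand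
    \<open>g * w\<close> of \<open>t\<close>.\<close>
  define i0 where "i0 = x * w * k'"
  have "t + i0 * e = (e * x) * w * k' + g * w + r" by (simp add: t i0_def algebra_simps)
  also have "\<dots> = k * (y * w * k' + g * w) + r"
    unfolding xy by (simp add: k' algebra_simps)
  finally have i0: "(t + i0 * e) mod k = r mod k" by simp
  have rk: "r < k"
  proof -
    have "g \<le> k" using k by (simp add: g_def dvd_imp_le)
    then show ?thesis using r by simp
  qed
  obtain c where c: "e = g * c" unfolding g_def by (meson dvdE gcd_dvd1)
  \<comment> \<open>Shifting an index by \<open>h\<close> adds \<open>h * e = k * c\<close>, a
    multiple of \<open>k\<close>, so the possibly large \<open>i0\<close> can be reduced modulo
    \<open>h\<close>.\<close>
  have step: "(t + (i0 mod h + q * h) * e) mod k = r" for q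
  proof -
    have he: "h * e = k * c" by (simp add: kgh c)
    have "i0 * e = (i0 mod h) * e + (i0 div h) * (h * e)"
      by (metis add.commute add_mult_distrib div_mult_mod_eq mult.assoc)
    then have "t + i0 * e = t + (i0 mod h) * e + k * (c * (i0 div h))"
      unfolding he by (simp add: ac_simps)
    then have "(t + (i0 mod h) * e) mod k = r" using i0 rk by (metis mod_mult_self2 mod_less)
    moreover have "q * h * e = k * (c * q)" by (simp add: kgh c)
    then have "t + (i0 mod h + q * h) * e = t + (i0 mod h) * e + k * (c * q)"
      by (simp add: distrib_right)
    ultimately show ?thesis by (metis mod_mult_self2)
  qed
  define J where "J = (\<lambda>q. i0 mod h + q * h) ` {..<g}"
  have cardJ: "card J = g"
    unfolding J_def using h by (subst card_image) (auto simp: inj_on_def)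
  have J: "J \<subseteq> {0..<k}"
  proof
    fix i assume "i \<in> J"
    then obtain q where q: "q < g" "i = i0 mod h + q * h" by (auto simp: J_def)
    have "i < Suc q * h" using q h by simp
    also have "\<dots> \<le> g * h" using q by (intro mult_le_mono1) simp
    finally show "i \<in> {0..<k}" by (simp add: kgh)
  qed
  have "(\<lambda>i. (t + i * e) mod (m * k)) ` J \<subseteq> {x \<in> P. x mod k = r}"
  proof
    fix z assume "z \<in> (\<lambda>i. (t + i * e) mod (m * k)) ` J"
    then obtain i where i: "i \<in> J" "z = (t + i * e) mod (m * k)" by auto
    have "z mod k = (t + i * e) mod k" unfolding i by (simp add: mod_mod_cancel)
    also have "\<dots> = r" using i(1) step by (auto simp: J_def)
    finally show "z \<in> {x \<in> P. x mod k = r}" using i J by (auto simp: P)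
  qed
  then have "card ((\<lambda>i. (t + i * e) mod (m * k)) ` J) \<le> card {x \<in> P. x mod k = r}"
    by (rule card_mono[rotated]) (simp add: P)
  moreover have "card ((\<lambda>i. (t + i * e) mod (m * k)) ` J) = g"
    using inj_on_subset[OF inj J] cardJ by (simp add: card_image)
  ultimately show thesis using that r by (simp add: g_def)
qed

lemma cyclic_ap_subset:
  assumes "cyclic_ap N k e P" "N > 0"
  shows "P \<subseteq> {0..<N}"
proof -
  from assms(1) obtain t where "P = (\<lambda>i. (t + i * e) mod N) ` {0..<k}"
    unfolding cyclic_ap_def by blast
  with assms(2) show ?thesis by auto
qed

text \<open>A residue class modulo \<open>k\<close> has only \<open>m\<close> points below
  \<open>m * k\<close>. This later keeps \<open>m + 1 - d i\<close> from being truncated.\<close>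

lemma cyclic_ap_gcd_le:
  assumes ap: "cyclic_ap (m * k) k e P" and "m > 0" "k > 0"
  shows "gcd e k \<le> m"
proof -
  obtain r where r: "gcd e k \<le> card {x \<in> P. x mod k = r}"
    using cyclic_ap_class[OF ap \<open>k > 0\<close>] by blast
  have "{x \<in> P. x mod k = r} \<subseteq> (\<lambda>s. r + k * s) ` {..<m}"
  proof
    fix x assume x: "x \<in> {x \<in> P. x mod k = r}"
    then have "x < m * k" using cyclic_ap_subset[OF ap] assms by auto
    then have "x div k < m" using \<open>k > 0\<close> by (simp add: div_less_iff_less_mult)
    moreover have "x = r + k * (x div k)" using x by auto
    ultimately show "x \<in> (\<lambda>s. r + k * s) ` {..<m}" by blast
  qed
  then have "card {x \<in> P. x mod k = r} \<le> m"
    using surj_card_le[of "{..<m}"] by simp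
  with r show ?thesis by simp
qed

text \<open>\<open>cyclic_ap\<close> allows any positive difference, \<open>ap_diff_gcds\<close>
  only those below the modulus. Reducing \<open>e\<close> modulo \<open>m * k\<close> preserves the
  progression and, as \<open>k\<close> divides the modulus, also the gcd.\<close>

lemma cyclic_ap_gcd_in:
  assumes ap: "cyclic_ap (m * k) k e P" and "m > 0" "k > 1"
  shows "gcd e k \<in> ap_diff_gcds (m * k) k"
proof -
  define e' where "e' = e mod (m * k)"
  from ap obtain t where t: "t < m * k" and card: "card P = k"
    and P: "P = (\<lambda>i. (t + i * e) mod (m * k)) ` {0..<k}"
    unfolding cyclic_ap_def by auto
  have eq: "(t + i * e) mod (m * k) = (t + i * e') mod (m * k)" for i
    unfolding e'_def by (metis mod_add_right_eq mod_mult_right_eq)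
  have P': "P = (\<lambda>i. (t + i * e') mod (m * k)) ` {0..<k}" using P eq by simp
  have "e' \<noteq> 0"
  proof
    assume "e' = 0"
    then have "P \<subseteq> {t mod (m * k)}" using P' by auto
    from card_mono[OF _ this] show False using card \<open>k > 1\<close> by simp
  qed
  then have "cyclic_ap (m * k) k e' P" using t card P' by (auto simp: cyclic_ap_def)
  moreover have "e' < m * k" unfolding e'_def using assms by simp
  then have "e' \<in> {1..m * k - 1}" using \<open>e' \<noteq> 0\<close> by auto
  moreover have "gcd e' k = gcd e k"
    unfolding e'_def by (metis gcd.commute gcd_red_nat mod_mod_cancel dvd_triv_right)
  ultimately show ?thesis unfolding ap_diff_gcds_def mem_Collect_eq by metis
qed

text \<open>Removing the \<open>m + 1 - f r\<close> smallest points of class \<open>r\<close> leaves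
  fewer than \<open>f r\<close>, too few for a progression that must have at least
  \<open>f r\<close> points there.\<close>

lemma max_ap_free_ge:
  fixes f :: "nat \<Rightarrow> nat"
  assumes "m > 0" "k > 1"
    and f: "\<And>r g. g \<in> ap_diff_gcds (m * k) k \<Longrightarrow> r < g \<Longrightarrow> r < n \<and> 0 < f r \<and> f r \<le> g"
  shows "m * k \<le> max_ap_free (m * k) k + (\<Sum>r<n. m + 1 - f r)"
proof -
  define A where "A = (\<Union>r<n. (\<lambda>s. r + k * s) ` {..<m + 1 - f r})"
  define B where "B = {0..<m * k} - A"
  have "card A \<le> (\<Sum>r<n. card ((\<lambda>s. r + k * s) ` {..<m + 1 - f r}))"
    unfolding A_def by (rule card_UN_le) simp
  also have "\<dots> \<le> (\<Sum>r<n. m + 1 - f r)"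
    by (intro sum_mono order_trans[OF card_image_le]) auto
  finally have A: "card A \<le> (\<Sum>r<n. m + 1 - f r)" .
  have "finite A" by (simp add: A_def)
  then have "card {0..<m * k} - card A \<le> card B"
    unfolding B_def by (rule diff_card_le_card_Diff)
  with A have cardB: "m * k \<le> card B + (\<Sum>r<n. m + 1 - f r)" by simp
  have "cyclic_ap_free (m * k) k B"
    unfolding cyclic_ap_free_def
  proof safe
    fix e P assume ap: "cyclic_ap (m * k) k e P" and PB: "P \<subseteq> B"
    obtain r where r: "r < gcd e k" "gcd e k \<le> card {x \<in> P. x mod k = r}"
      using cyclic_ap_class[OF ap] \<open>k > 1\<close> by auto
    have fr: "r < n" "0 < f r" "f r \<le> gcd e k"
      using f[OF cyclic_ap_gcd_in[OF ap] r(1)] assms by auto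
    have "{x \<in> P. x mod k = r} \<subseteq> (\<lambda>s. r + k * s) ` {m + 1 - f r..<m}"
    proof
      fix x assume x: "x \<in> {x \<in> P. x mod k = r}"
      then have xr: "x = r + k * (x div k)" by auto
      have "x < m * k" using x PB by (auto simp: B_def)
      then have "x div k < m" using \<open>k > 1\<close> by (simp add: div_less_iff_less_mult)
      moreover have "\<not> x div k < m + 1 - f r"
      proof
        assume "x div k < m + 1 - f r"
        with xr fr(1) have "x \<in> A" unfolding A_def by blast
        with x PB show False by (auto simp: B_def)
      qed
      ultimately show "x \<in> (\<lambda>s. r + k * s) ` {m + 1 - f r..<m}"
        using xr by (intro image_eqI) auto
    qed
    then have "card {x \<in> P. x mod k = r} \<le> card {m + 1 - f r..<m}"
      by (rule surj_card_le[rotated]) simp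
    \<comment> \<open>If \<open>f r > m + 1\<close>, the truncated difference is 0 and
      \<open>m\<close> points remain, still fewer than \<open>f r\<close>; otherwise
      \<open>f r - 1\<close> remain.\<close>
    also have "\<dots> < f r" using fr \<open>m > 0\<close> by auto
    finally show False using r fr by simp
  qed
  then have "card B \<le> max_ap_free (m * k) k"
    unfolding max_ap_free_def
    by (intro Max_ge finite_free_cards) (auto simp: B_def)
  with cardB show ?thesis by simp
qed

text \<open>The range below \<open>d j\<close> splits into blocks from \<open>d (i - 1)\<close> to
  \<open>d i\<close> on which \<open>h\<close> is constant. Induction starts at
  \<open>j = -1\<close>, where both sums are empty because \<open>d (-1) = 0\<close>.\<close>

lemma sum_layers:
  fixes d :: "int \<Rightarrow> nat" and h :: "nat \<Rightarrow> int" and H :: "int \<Rightarrow> int"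
  assumes "d (-1) = 0"
    and "-1 \<le> j"
    and "\<And>i. 0 \<le> i \<Longrightarrow> i \<le> j \<Longrightarrow> d (i - 1) \<le> d i"
    and "\<And>i r. 0 \<le> i \<Longrightarrow> i \<le> j \<Longrightarrow> d (i - 1) \<le> r \<Longrightarrow> r < d i \<Longrightarrow> h r = H i"
  shows "(\<Sum>r<d j. h r) = (\<Sum>i=0..j. (int (d i) - int (d (i - 1))) * H i)"
  using assms(2-)
proof (induction j rule: int_ge_induct)
  case base
  then show ?case using assms(1) by simp
next
  case (step j)
  have le: "d j \<le> d (j + 1)" using step.prems(1)[of "j + 1"] step.hyps by simp
  have IH: "(\<Sum>r<d j. h r) = (\<Sum>i=0..j. (int (d i) - int (d (i - 1))) * H i)"
    using step.prems by (intro step.IH) auto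
  have "{..<d (j + 1)} = {..<d j} \<union> {d j..<d (j + 1)}" using le by auto
  then have "(\<Sum>r<d (j + 1). h r) = (\<Sum>r<d j. h r) + (\<Sum>r=d j..<d (j + 1). h r)"
    by (simp add: sum.union_disjoint ivl_disj_int)
  also have "(\<Sum>r=d j..<d (j + 1). h r) = (\<Sum>r=d j..<d (j + 1). H (j + 1))"
    using step.hyps by (intro sum.cong step.prems) auto
  also have "\<dots> = (int (d (j + 1)) - int (d j)) * H (j + 1)"
    using le by (simp add: of_nat_diff)
  finally have *: "(\<Sum>r<d (j + 1). h r) =
    (\<Sum>i=0..j. (int (d i) - int (d (i - 1))) * H i) + (int (d (j + 1)) - int (d j)) * H (j + 1)"
    using IH by simp
  have "{0..j + 1} = insert (j + 1) {0..j}" using step.hyps by auto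
  then show ?case using * by simp
qed

theorem theorem1p3:
  fixes m k :: nat and j :: int and d :: "int \<Rightarrow> nat"
  assumes "m \<ge> 1" and "k \<ge> 3" and "j \<ge> 0"
    and "ap_diff_gcds (m * k) k = d ` {0..j}"
    and "strict_mono_on {0..j} d"
    and "d (-1) = 0"
  shows "int m * int k - int m \<ge> int (max_ap_free (m * k) k) \<and>
    int (max_ap_free (m * k) k) \<ge>
      int m * int k - (\<Sum>i=0..j. (int (d i) - int (d (i - 1))) * (int m - int (d i) + 1))"
proof
  have "int (max_ap_free (m * k) k + m) \<le> int (m * k)"
    using max_ap_free_le[of k m] assms(2) by (simp only: of_nat_le_iff)
  then show "int m * int k - int m \<ge> int (max_ap_free (m * k) k)" by simp
next
  define f where "f r = Min {g \<in> d ` {0..j}. r < g}" for r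
  have f_le: "f r \<le> g" and f_pos: "r < f r" if "g \<in> d ` {0..j}" "r < g" for r g
  proof -
    have fin: "finite {g \<in> d ` {0..j}. r < g}" by simp
    show "f r \<le> g" unfolding f_def using fin that by (intro Min_le) auto
    have "f r \<in> {g \<in> d ` {0..j}. r < g}"
      unfolding f_def using fin that by (intro Min_in) auto
    then show "r < f r" by simp
  qed
  have mono: "d a < d b \<longleftrightarrow> a < b" if "a \<in> {0..j}" "b \<in> {0..j}" for a b
    using assms(5) that by (rule strict_mono_on_less)
  have mono_le: "d a \<le> d b \<longleftrightarrow> a \<le> b" if "a \<in> {0..j}" "b \<in> {0..j}" for a b
    using mono[OF that(2,1)] by linarith
  have f_eq: "f r = d i" if "0 \<le> i" "i \<le> j" "d (i - 1) \<le> r" "r < d i" for i r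
    unfolding f_def
  proof (rule Min_eqI)
    fix g assume "g \<in> {g \<in> d ` {0..j}. r < g}"
    then obtain a where a: "a \<in> {0..j}" "g = d a" "r < d a" by auto
    \<comment> \<open>If \<open>a < i\<close>, then \<open>i - 1\<close> is still a valid index
      since \<open>a\<close> is nonnegative, and \<open>d a \<le> d (i - 1) \<le> r\<close>
      contradicts \<open>r < d a\<close>.\<close>
    have "i \<le> a"
    proof (rule ccontr)
      assume "\<not> i \<le> a"
      then have "d a \<le> d (i - 1)" using a that by (subst mono_le) auto
      with a that show False by simp
    qed
    then show "d i \<le> g" using a that mono_le by simp
  qed (use that in auto)
  have d_le: "d i \<le> m" if "0 \<le> i" "i \<le> j" for i
  proof -
    have "d i \<in> ap_diff_gcds (m * k) k" using that assms(4) by auto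
    then show ?thesis
      unfolding ap_diff_gcds_def using cyclic_ap_gcd_le assms(1,2) by fastforce
  qed
  \<comment> \<open>For \<open>i = 0\<close> the predecessor -1 lies outside the range of
    monotonicity, and the convention \<open>d (-1) = 0\<close> takes over.\<close>
  have step: "d (i - 1) \<le> d i" if "0 \<le> i" "i \<le> j" for i
  proof (cases "i = 0")
    case True
    then show ?thesis using assms(6) by simp
  next
    case False
    then show ?thesis using that by (subst mono_le) auto
  qed
  have "m * k \<le> max_ap_free (m * k) k + (\<Sum>r<d j. m + 1 - f r)"
  proof (rule max_ap_free_ge)
    fix r g assume "g \<in> ap_diff_gcds (m * k) k" and r: "r < g"
    then have g: "g \<in> d ` {0..j}" using assms(4) by simp
    then have "g \<le> d j" using assms(3) by (auto simp: mono_le)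
    with f_le[OF g r] f_pos[OF g r] r show "r < d j \<and> 0 < f r \<and> f r \<le> g" by simp
  qed (use assms in auto)
  then have "int (m * k) \<le> int (max_ap_free (m * k) k + (\<Sum>r<d j. m + 1 - f r))"
    by (simp only: of_nat_le_iff)
  moreover have "(\<Sum>r<d j. int (m + 1 - f r))
      = (\<Sum>i=0..j. (int (d i) - int (d (i - 1))) * (int m - int (d i) + 1))"
  proof (rule sum_layers)
    fix i r assume "0 \<le> i" "i \<le> j" "d (i - 1) \<le> r" "r < d i"
    then show "int (m + 1 - f r) = int m - int (d i) + 1"
      using f_eq[of i r] d_le[of i] by (simp add: of_nat_diff)
  qed (use assms step in auto)
  ultimately show "int (max_ap_free (m * k) k) \<ge>
      int m * int k - (\<Sum>i=0..j. (int (d i) - int (d (i - 1))) * (int m - int (d i) + 1))"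
    by simp
qed

end
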